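(* Let $n\geq 1$, $R=\mathbb{Z}[t^{\pm1}]$ and $S=\mathbb{Z}[t^{\pm 1}]/(t^2-1)$. Let $\mathbf{LB}_n$ act $S$-linearly on $S^{\oplus n}$ by the reduction modulo $t^2-1$ (that is, $-\otimes_R S$) of the unreduced Burau representation $\mathbf{LB}_n\to\mathrm{GL}_n(R)$, $$\tau_i\longmapsto I_{i-1}\oplus\begin{bmatrix}0&1\\1&0\end{bmatrix}\oplus I_{n-i-1},\qquad \sigma_i\longmapsto I_{i-1}\oplus\begin{bmatrix}1-t&1\\t&0\end{bmatrix}\oplus I_{n-i-1}\qquad(1\le i\le n-1).$$ Then this action extends to an $S$-linear action of the extended loop braid group $\mathbf{LB}'_n$ on $S^{\oplus n}$. Explicitly, there is a homomorphism $\mathbf{LB}'_n\to\mathrm{GL}_n(S)$ given on $\tau_i$ and $\sigma_i$ ($1\le i\le n-1$) by the matrices above, and on $\rho_i$ ($1\le i\le n$) by $$\rho_i\longmapsto I_{i-1}\oplus\begin{bmatrix}-t\end{bmatrix}\oplus I_{n-i}.$$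
   Context: Loop braid groups. Let $\mathbb{D}^3$ be the closed unit ball in $\mathbb{R}^3$ and $U_n$ a fixed oriented trivial $n$-component link in its interior. Let $\mathrm{Emb}^u(U_n,\mathbb{D}^3)$ be the path-component of the inclusion in the space of smooth embeddings of $U_n$ into the interior of $\mathbb{D}^3$ (smooth Whitney topology). Put $\mathcal{E}(U_n,\mathbb{D}^3)=\mathrm{Emb}^u(U_n,\mathbb{D}^3)/\mathrm{Diff}(U_n)$ and $\mathcal{E}^+(U_n,\mathbb{D}^3)=\mathrm{Emb}^u(U_n,\mathbb{D}^3)/\mathrm{Diff}^+(U_n)$, where $\mathrm{Diff}^+$ means orientation-preserving diffeomorphisms. The extended loop braid group is $\mathbf{LB}'_n=\pi_1(\mathcal{E}(U_n,\mathbb{D}^3))$ and the loop braid group is $\mathbf{LB}_n=\pi_1(\mathcal{E}^+(U_n,\mathbb{D}^3))$. The $2^n$-sheeted covering $\mathcal{E}^+\to\mathcal{E}$ makes $\mathbf{LB}_n$ a subgroup of index $2^n$ of $\mathbf{LB}'_n$. Take the basepoint to be $n$ circles in the $xy$-plane arranged in a row from left to right. $\mathbf{LB}_n$ is generated by $\tau_1,\dots,\tau_{n-1},\sigma_1,\dots,\sigma_{n-1}$, and $\mathbf{LB}'_n$ by these together with $\rho_1,\dots,\rho_n$. Both $\tau_i$ and $\sigma_i$ exchange the $i$-th and $(i+1)$-st circles; for $\tau_i$ no circle passes through the other, and for $\sigma_i$ the $i$-th circle passes through the $(i+1)$-st. The element $\rho_i$ flips the $i$-th circle by a half-rotation, reversing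 its orientation. $\mathbf{LB}'_n$ is also the group of isotopy classes of diffeomorphisms of $\mathbb{D}^3$, equal to the identity near $\partial\mathbb{D}^3$, preserving $U_n$ setwise. It thus acts on $\pi_1(\mathbb{D}^3\smallsetminus U_n)=F_n=\langle a_1,\dots,a_n\rangle$, where $a_j$ is a loop going once through the $j$-th circle. It is standard that this action is faithful, so $\mathbf{LB}'_n$ may be viewed as the subgroup of $\mathrm{Aut}(F_n)$ generated by $\tau_i:\ a_i\mapsto a_{i+1},\ a_{i+1}\mapsto a_i$; $\sigma_i:\ a_i\mapsto a_ia_{i+1}a_i^{-1},\ a_{i+1}\mapsto a_i$; and $\rho_i:\ a_i\mapsto a_i^{-1}$ (each fixing all other $a_j$), and $\mathbf{LB}_n$ as the subgroup generated by the $\tau_i$ and $\sigma_i$. Products are composed from right to left, as functions. Matrices act on column vectors. *)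

theory Defs
  imports
    "HOL-Algebra.Bij"
    "HOL-Algebra.Generated_Groups"
    "HOL-Library.Poly_Mapping"
    "Jordan_Normal_Form.Matrix"
begin

section \<open>The free group on \<open>a\<^sub>1, \<dots>, a\<^sub>n\<close>\<close>

text \<open>The letter \<open>(j, True)\<close> stands for \<open>a\<^sub>j\<close> and \<open>(j, False)\<close> for its inverse.\<close>

type_synonym letter = "nat \<times> bool"

fun inv_letter :: "letter \<Rightarrow> letter" where
  "inv_letter (j, e) = (j, \<not> e)"

definition reduced :: "letter list \<Rightarrow> bool" where
  "reduced w \<longleftrightarrow> successively (\<lambda>x y. y \<noteq> inv_letter x) w"

fun cons_red :: "letter \<Rightarrow> letter list \<Rightarrow> letter list" where
  "cons_red x [] = [x]"
| "cons_red x (y # w) = (if y = inv_letter x then w else x # y # w)"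

definition free_group :: "nat \<Rightarrow> letter list monoid" where
  "free_group n =
     \<lparr>carrier = {w. reduced w \<and> fst ` set w \<subseteq> {1..n}},
      monoid.mult = (\<lambda>u v. foldr cons_red u v),
      one = []\<rparr>"

definition gen :: "nat \<Rightarrow> letter list" where
  "gen j = [(j, True)]"

lemma inv_letter_inv_letter [simp]: "inv_letter (inv_letter x) = x"
  by (cases x) simp

lemma fst_inv_letter [simp]: "fst (inv_letter x) = fst x"
  by (cases x) simp

lemma snd_inv_letter [simp]: "snd (inv_letter x) \<longleftrightarrow> \<not> snd x"
  by (cases x) simp

lemma inv_letter_neq [simp]: "inv_letter x \<noteq> x" "x \<noteq> inv_letter x"
  by (cases x, simp)+

lemma reduced_Nil [simp]: "reduced []"
  by (simp add: reduced_def)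

lemma reduced_tl: "reduced (x # w) \<Longrightarrow> reduced w"
  by (auto simp: reduced_def successively_Cons)

lemma reduced_cons_red: "reduced w \<Longrightarrow> reduced (cons_red x w)"
  by (cases w) (auto simp: reduced_def successively_Cons)

lemma reduced_foldr: "reduced v \<Longrightarrow> reduced (foldr cons_red u v)"
  by (induction u) (auto intro: reduced_cons_red)

lemma cons_red_reduced: "reduced (x # w) \<Longrightarrow> cons_red x w = x # w"
  by (cases w) (auto simp: reduced_def)

lemma cons_red_cancel:
  assumes "reduced w"
  shows "cons_red x (cons_red (inv_letter x) w) = w"
proof (cases w)
  case (Cons y w')
  show ?thesis
  proof (cases "y = x")
    case True
    with Cons assms show ?thesis by (simp add: cons_red_reduced)
  qed (use Cons in simp)
qed simp

lemma foldr_cons_red: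
  assumes "reduced v"
  shows "foldr cons_red (cons_red x u) v = cons_red x (foldr cons_red u v)"
proof (cases u)
  case (Cons y u')
  have "cons_red x (cons_red (inv_letter x) (foldr cons_red u' v)) = foldr cons_red u' v"
    by (intro cons_red_cancel reduced_foldr assms)
  with Cons show ?thesis by simp
qed simp

lemma foldr_cons_red_assoc:
  "reduced w \<Longrightarrow> foldr cons_red (foldr cons_red u v) w = foldr cons_red u (foldr cons_red v w)"
  by (induction u) (simp_all add: foldr_cons_red)

lemma set_cons_red: "set (cons_red x w) \<subseteq> insert x (set w)"
  by (cases w) auto

lemma set_foldr_cons_red: "set (foldr cons_red u v) \<subseteq> set u \<union> set v"
proof (induction u)
  case (Cons x u)
  then show ?case using set_cons_red[of x "foldr cons_red u v"] by auto
qed simp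

lemma fst_set_foldr_cons_red:
  "fst ` set u \<subseteq> A \<Longrightarrow> fst ` set v \<subseteq> A \<Longrightarrow> fst ` set (foldr cons_red u v) \<subseteq> A"
  using image_mono[OF set_foldr_cons_red[of u v], of fst] unfolding image_Un by blast

lemma foldr_Nil_reduced: "reduced w \<Longrightarrow> foldr cons_red w [] = w"
proof (induction w)
  case (Cons x w)
  then show ?case using reduced_tl[OF Cons.prems] by (simp add: cons_red_reduced)
qed simp

lemma foldr_inverse:
  assumes "reduced v"
  shows "foldr cons_red (rev (map inv_letter w)) (foldr cons_red w v) = v"
  using assms
proof (induction w arbitrary: v)
  case (Cons x w)
  have "cons_red (inv_letter x) (cons_red (inv_letter (inv_letter x)) (foldr cons_red w v))
      = foldr cons_red w v"
    by (intro cons_red_cancel reduced_foldr Cons.prems)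
  with Cons show ?case by simp
qed simp

lemma reduced_rev_inv: "reduced w \<Longrightarrow> reduced (rev (map inv_letter w))"
proof -
  have "successively (\<lambda>x y. y \<noteq> inv_letter x) (rev (map inv_letter w)) \<longleftrightarrow>
      successively (\<lambda>x y. inv_letter x \<noteq> inv_letter (inv_letter y)) w"
    by (simp add: successively_rev successively_map)
  also have "\<dots> \<longleftrightarrow> reduced w"
    unfolding reduced_def by (rule arg_cong2[where f = successively]) (auto simp: fun_eq_iff)
  finally show "reduced w \<Longrightarrow> reduced (rev (map inv_letter w))"
    by (simp add: reduced_def)
qed

theorem group_free_group: "group (free_group n)"
proof (rule groupI)
  fix u v w
  assume "u \<in> carrier (free_group n)" "v \<in> carrier (free_group n)"
  then show "u \<otimes>\<^bsub>free_group n\<^esub> v \<in> carrier (free_group n)"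
    by (simp add: free_group_def reduced_foldr fst_set_foldr_cons_red)
  assume "w \<in> carrier (free_group n)"
  then show "u \<otimes>\<^bsub>free_group n\<^esub> v \<otimes>\<^bsub>free_group n\<^esub> w =
      u \<otimes>\<^bsub>free_group n\<^esub> (v \<otimes>\<^bsub>free_group n\<^esub> w)"
    by (simp add: free_group_def foldr_cons_red_assoc)
next
  fix w
  assume w: "w \<in> carrier (free_group n)"
  then show "\<exists>v\<in>carrier (free_group n). v \<otimes>\<^bsub>free_group n\<^esub> w = \<one>\<^bsub>free_group n\<^esub>"
    using foldr_inverse[of "[]" w]
    by (intro bexI[of _ "rev (map inv_letter w)"])
      (auto simp: free_group_def reduced_rev_inv foldr_Nil_reduced)
qed (auto simp: free_group_def)

lemma gen_closed: "j \<in> {1..n} \<Longrightarrow> gen j \<in> carrier (free_group n)"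
  by (simp add: gen_def free_group_def reduced_def)

definition letter_val :: "('a, 'b) monoid_scheme \<Rightarrow> (nat \<Rightarrow> 'a) \<Rightarrow> letter \<Rightarrow> 'a" where
  "letter_val G f x = (if snd x then f (fst x) else inv\<^bsub>G\<^esub> f (fst x))"

definition word_val :: "('a, 'b) monoid_scheme \<Rightarrow> (nat \<Rightarrow> 'a) \<Rightarrow> letter list \<Rightarrow> 'a" where
  "word_val G f w = foldr (\<lambda>x g. letter_val G f x \<otimes>\<^bsub>G\<^esub> g) w \<one>\<^bsub>G\<^esub>"

text \<open>The universal property of the free group: \<^term>\<open>word_val G f\<close> is the homomorphism into \<open>G\<close>
  with values \<open>f j\<close> on the generators, and it is the only one.\<close>

lemma letter_val_closed:
  assumes "group G" "f \<in> {1..n} \<rightarrow> carrier G" "fst x \<in> {1..n}"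
  shows "letter_val G f x \<in> carrier G"
  using assms by (auto simp: letter_val_def intro: group.inv_closed)

lemma word_val_closed:
  assumes "group G" "f \<in> {1..n} \<rightarrow> carrier G" "fst ` set w \<subseteq> {1..n}"
  shows "word_val G f w \<in> carrier G"
  using assms(3)
proof (induction w)
  case Nil
  interpret group G by fact
  show ?case by (simp add: word_val_def)
next
  case (Cons x w)
  interpret group G by fact
  have "letter_val G f x \<in> carrier G"
    using Cons.prems by (intro letter_val_closed[OF assms(1,2)]) simp
  with Cons show ?case by (simp add: word_val_def)
qed

lemma word_val_cons_red:
  assumes "group G" "f \<in> {1..n} \<rightarrow> carrier G" "fst x \<in> {1..n}" "fst ` set w \<subseteq> {1..n}"
  shows "word_val G f (cons_red x w) = letter_val G f x \<otimes>\<^bsub>G\<^esub> word_val G f w"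
proof (cases "\<exists>w'. w = inv_letter x # w'")
  case True
  then obtain w' where w: "w = inv_letter x # w'" by blast
  interpret group G by fact
  have fx: "f (fst x) \<in> carrier G"
    using assms by blast
  have wv: "word_val G f w' \<in> carrier G"
    using assms(4) w by (intro word_val_closed[OF assms(1,2)]) simp
  have "letter_val G f x \<otimes>\<^bsub>G\<^esub> (letter_val G f (inv_letter x) \<otimes>\<^bsub>G\<^esub> word_val G f w') = word_val G f w'"
    using fx wv by (simp add: letter_val_def m_assoc[symmetric])
  then show ?thesis by (simp add: w word_val_def)
next
  case False
  then have "cons_red x w = x # w" by (cases w) auto
  then show ?thesis by (simp add: word_val_def)
qed

theorem word_val_hom:
  assumes "group G" "f \<in> {1..n} \<rightarrow> carrier G"
  shows "word_val G f \<in> hom (free_group n) G"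
proof (rule homI)
  fix u v
  assume "u \<in> carrier (free_group n)"
  then show "word_val G f u \<in> carrier G"
    by (intro word_val_closed[OF assms]) (simp add: free_group_def)
  assume "v \<in> carrier (free_group n)"
  then have v: "fst ` set v \<subseteq> {1..n}" by (simp add: free_group_def)
  have "fst ` set u \<subseteq> {1..n}"
    using \<open>u \<in> _\<close> by (simp add: free_group_def)
  then have "word_val G f (foldr cons_red u v) = word_val G f u \<otimes>\<^bsub>G\<^esub> word_val G f v"
  proof (induction u)
    case Nil
    interpret group G by fact
    show ?case using word_val_closed[OF assms v] by (simp add: word_val_def)
  next
    case (Cons x u)
    interpret group G by fact
    have "fst ` set (foldr cons_red u v) \<subseteq> {1..n}"
      using Cons.prems v by (intro fst_set_foldr_cons_red) auto
    then have "word_val G f (foldr cons_red (x # u) v)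
        = letter_val G f x \<otimes>\<^bsub>G\<^esub> word_val G f (foldr cons_red u v)"
      using Cons.prems by (simp add: word_val_cons_red[OF assms])
    also have "\<dots> = letter_val G f x \<otimes>\<^bsub>G\<^esub> (word_val G f u \<otimes>\<^bsub>G\<^esub> word_val G f v)"
      using Cons by simp
    also have "\<dots> = (letter_val G f x \<otimes>\<^bsub>G\<^esub> word_val G f u) \<otimes>\<^bsub>G\<^esub> word_val G f v"
      using Cons.prems v by (intro m_assoc[symmetric] word_val_closed[OF assms] letter_val_closed[OF assms]) auto
    finally show ?case by (simp add: word_val_def)
  qed
  then show "word_val G f (u \<otimes>\<^bsub>free_group n\<^esub> v) = word_val G f u \<otimes>\<^bsub>G\<^esub> word_val G f v"
    by (simp add: free_group_def)
qed

lemma word_val_gen: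
  assumes "group G" "f \<in> {1..n} \<rightarrow> carrier G" "j \<in> {1..n}"
  shows "word_val G f (gen j) = f j"
proof -
  interpret group G by fact
  have "f j \<in> carrier G" using assms by blast
  then show ?thesis by (simp add: word_val_def letter_val_def gen_def)
qed

theorem free_group_hom_eqI:
  assumes G: "group G" and h: "h \<in> hom (free_group n) G" and k: "k \<in> hom (free_group n) G"
    and eq: "\<And>j. j \<in> {1..n} \<Longrightarrow> h (gen j) = k (gen j)"
    and w: "w \<in> carrier (free_group n)"
  shows "h w = k w"
  using w
proof (induction w)
  case Nil
  have "h \<one>\<^bsub>free_group n\<^esub> = k \<one>\<^bsub>free_group n\<^esub>"
    using hom_one[OF h group_free_group G] hom_one[OF k group_free_group G] by simp
  then show ?case by (simp add: free_group_def)
next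
  case (Cons x w)
  interpret F: group "free_group n" by (rule group_free_group)
  interpret G: group G by fact
  interpret hh: group_hom "free_group n" G h by unfold_locales (rule h)
  interpret kk: group_hom "free_group n" G k by unfold_locales (rule k)
  have x: "fst x \<in> {1..n}" and w: "w \<in> carrier (free_group n)"
    using Cons.prems by (auto simp: free_group_def dest: reduced_tl)
  have g: "gen (fst x) \<in> carrier (free_group n)" using x by (rule gen_closed)
  have inv: "inv\<^bsub>free_group n\<^esub> gen (fst x) = [(fst x, False)]"
    by (rule F.inv_equality) (use x g in \<open>auto simp: free_group_def gen_def reduced_def\<close>)
  have xc: "[x] \<in> carrier (free_group n)" using x by (auto simp: free_group_def reduced_def)
  have "h [x] = k [x]"
  proof (cases "snd x")
    case True
    then have "[x] = gen (fst x)" by (cases x) (simp add: gen_def)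
    then show ?thesis using eq[OF x] by simp
  next
    case False
    then have "[x] = inv\<^bsub>free_group n\<^esub> gen (fst x)" unfolding inv by (cases x) simp
    then show ?thesis using eq[OF x] g by simp
  qed
  moreover have "x # w = [x] \<otimes>\<^bsub>free_group n\<^esub> w"
    using Cons.prems by (simp add: free_group_def cons_red_reduced)
  ultimately show ?case
    using Cons.IH[OF w] xc w by simp
qed

text \<open>The endomorphism of the free group sending each \<open>a\<^sub>j\<close> to \<open>f j\<close>. It is restricted to the
  carrier because the elements of \<^const>\<open>AutoGroup\<close> are extensional functions.\<close>

definition free_endo :: "nat \<Rightarrow> (nat \<Rightarrow> letter list) \<Rightarrow> letter list \<Rightarrow> letter list" where
  "free_endo n f = restrict (word_val (free_group n) f) (carrier (free_group n))"

lemma free_endo_hom: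
  assumes "f \<in> {1..n} \<rightarrow> carrier (free_group n)"
  shows "free_endo n f \<in> hom (free_group n) (free_group n)"
proof -
  have "word_val (free_group n) f \<in> hom (free_group n) (free_group n)"
    by (rule word_val_hom[OF group_free_group assms])
  then show ?thesis
    unfolding free_endo_def by (rule group.hom_restrict[OF group_free_group]) simp
qed

lemma free_endo_gen:
  assumes "f \<in> {1..n} \<rightarrow> carrier (free_group n)" "j \<in> {1..n}"
  shows "free_endo n f (gen j) = f j"
  unfolding free_endo_def using assms word_val_gen[OF group_free_group assms] gen_closed by simp

lemma free_endo_auto:
  assumes f: "f \<in> {1..n} \<rightarrow> carrier (free_group n)" and g: "g \<in> {1..n} \<rightarrow> carrier (free_group n)"
    and gf: "\<And>j. j \<in> {1..n} \<Longrightarrow> free_endo n g (f j) = gen j"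
    and fg: "\<And>j. j \<in> {1..n} \<Longrightarrow> free_endo n f (g j) = gen j"
  shows "free_endo n f \<in> auto (free_group n)"
proof -
  let ?F = "free_group n"
  have id: "free_endo n g' (free_endo n f' w) = w"
    if f': "f' \<in> {1..n} \<rightarrow> carrier ?F" and g': "g' \<in> {1..n} \<rightarrow> carrier ?F"
      and eq: "\<And>j. j \<in> {1..n} \<Longrightarrow> free_endo n g' (f' j) = gen j" and w: "w \<in> carrier ?F"
    for f' g' w
  proof -
    have "(free_endo n g' \<circ> free_endo n f') w = id w"
    proof (rule free_group_hom_eqI[OF group_free_group _ _ _ w])
      show "free_endo n g' \<circ> free_endo n f' \<in> hom ?F ?F"
        by (rule hom_compose[OF free_endo_hom[OF f'] free_endo_hom[OF g']])
      show "id \<in> hom ?F ?F" by (simp add: hom_def)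
    qed (simp add: free_endo_gen[OF f'] eq)
    then show ?thesis by simp
  qed
  have "bij_betw (free_endo n f) (carrier ?F) (carrier ?F)"
    by (rule bij_betw_byWitness[where f' = "free_endo n g"])
      (use id[OF f g gf] id[OF g f fg] free_endo_hom[OF f] free_endo_hom[OF g]
        in \<open>auto simp: hom_def\<close>)
  moreover have "free_endo n f \<in> extensional (carrier ?F)"
    by (simp add: free_endo_def)
  ultimately show ?thesis
    using free_endo_hom[OF f] by (simp add: auto_def Bij_def)
qed


section \<open>Loop braid groups as groups of automorphisms of the free group\<close>

text \<open>Multiplication in \<^const>\<open>AutoGroup\<close> is composition of functions from right to left.\<close>

definition tau :: "nat \<Rightarrow> nat \<Rightarrow> letter list \<Rightarrow> letter list" where
  "tau n i = free_endo n (gen(i := gen (i + 1), i + 1 := gen i))"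

definition sigma :: "nat \<Rightarrow> nat \<Rightarrow> letter list \<Rightarrow> letter list" where
  "sigma n i = free_endo n
     (gen(i := gen i \<otimes>\<^bsub>free_group n\<^esub> gen (i + 1) \<otimes>\<^bsub>free_group n\<^esub> inv\<^bsub>free_group n\<^esub> gen i,
          i + 1 := gen i))"

definition rho :: "nat \<Rightarrow> nat \<Rightarrow> letter list \<Rightarrow> letter list" where
  "rho n i = free_endo n (gen(i := inv\<^bsub>free_group n\<^esub> gen i))"

definition LB :: "nat \<Rightarrow> (letter list \<Rightarrow> letter list) monoid" where
  "LB n = (AutoGroup (free_group n))
     \<lparr>carrier := generate (AutoGroup (free_group n)) (tau n ` {1..<n} \<union> sigma n ` {1..<n})\<rparr>"

definition LB_ext :: "nat \<Rightarrow> (letter list \<Rightarrow> letter list) monoid" where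
  "LB_ext n = (AutoGroup (free_group n))
     \<lparr>carrier := generate (AutoGroup (free_group n))
        (tau n ` {1..<n} \<union> sigma n ` {1..<n} \<union> rho n ` {1..n})\<rparr>"

lemma tau_auto:
  assumes "i \<in> {1..<n}"
  shows "tau n i \<in> auto (free_group n)"
proof -
  let ?f = "gen(i := gen (i + 1), i + 1 := gen i)"
  have f: "?f \<in> {1..n} \<rightarrow> carrier (free_group n)"
    using assms by (auto intro!: gen_closed)
  have "free_endo n ?f (?f j) = gen j" if "j \<in> {1..n}" for j
  proof -
    consider "j = i" | "j = i + 1" | "j \<noteq> i" "j \<noteq> i + 1" by blast
    then show ?thesis
      using assms that free_endo_gen[OF f, of i] free_endo_gen[OF f, of "i + 1"]
        free_endo_gen[OF f, of j]
      by cases simp_all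
  qed
  note inverse = this
  show ?thesis
    unfolding tau_def by (rule free_endo_auto[OF f f inverse inverse])
qed

lemma rho_auto:
  assumes "i \<in> {1..n}"
  shows "rho n i \<in> auto (free_group n)"
proof -
  interpret F: group "free_group n" by (rule group_free_group)
  let ?f = "gen(i := inv\<^bsub>free_group n\<^esub> gen i)"
  have f: "?f \<in> {1..n} \<rightarrow> carrier (free_group n)"
    using assms by (auto intro!: gen_closed F.inv_closed)
  interpret h: group_hom "free_group n" "free_group n" "free_endo n ?f"
    by unfold_locales (rule free_endo_hom[OF f])
  note [simp] = gen_closed free_endo_gen[OF f]
  have "free_endo n ?f (?f j) = gen j" if "j \<in> {1..n}" for j
    using that by (cases "j = i") simp_all
  note inverse = this
  show ?thesis
    unfolding rho_def by (rule free_endo_auto[OF f f inverse inverse])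
qed

lemma sigma_auto:
  assumes "i \<in> {1..<n}"
  shows "sigma n i \<in> auto (free_group n)"
proof -
  interpret F: group "free_group n" by (rule group_free_group)
  let ?a = "gen i" and ?b = "gen (i + 1)"
  let ?f = "gen(i := ?a \<otimes>\<^bsub>free_group n\<^esub> ?b \<otimes>\<^bsub>free_group n\<^esub> inv\<^bsub>free_group n\<^esub> ?a, i + 1 := ?a)"
  let ?g = "gen(i := ?b, i + 1 := inv\<^bsub>free_group n\<^esub> ?b \<otimes>\<^bsub>free_group n\<^esub> ?a \<otimes>\<^bsub>free_group n\<^esub> ?b)"
  have ab: "?a \<in> carrier (free_group n)" "?b \<in> carrier (free_group n)"
    using assms by (auto intro!: gen_closed)
  have f: "?f \<in> {1..n} \<rightarrow> carrier (free_group n)" and g: "?g \<in> {1..n} \<rightarrow> carrier (free_group n)"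
    using ab by (auto intro!: gen_closed)
  define h where "h = free_endo n ?f"
  define k where "k = free_endo n ?g"
  interpret h: group_hom "free_group n" "free_group n" h
    unfolding h_def by unfold_locales (rule free_endo_hom[OF f])
  interpret k: group_hom "free_group n" "free_group n" k
    unfolding k_def by unfold_locales (rule free_endo_hom[OF g])
  note hgen = free_endo_gen[OF f, folded h_def]
  note kgen = free_endo_gen[OF g, folded k_def]
  have fv: "h ?a = ?a \<otimes>\<^bsub>free_group n\<^esub> ?b \<otimes>\<^bsub>free_group n\<^esub> inv\<^bsub>free_group n\<^esub> ?a"
      "h ?b = ?a"
    using assms hgen[of i] hgen[of "i + 1"] by simp_all
  have gv: "k ?a = ?b"
      "k ?b = inv\<^bsub>free_group n\<^esub> ?b \<otimes>\<^bsub>free_group n\<^esub> ?a \<otimes>\<^bsub>free_group n\<^esub> ?b"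
    using assms kgen[of i] kgen[of "i + 1"] by simp_all
  have canc: "inv\<^bsub>free_group n\<^esub> x \<otimes>\<^bsub>free_group n\<^esub> (x \<otimes>\<^bsub>free_group n\<^esub> y) = y"
      "x \<otimes>\<^bsub>free_group n\<^esub> (inv\<^bsub>free_group n\<^esub> x \<otimes>\<^bsub>free_group n\<^esub> y) = y"
    if "x \<in> carrier (free_group n)" "y \<in> carrier (free_group n)" for x y
    using that by (simp_all add: F.m_assoc[symmetric])
  show ?thesis
    unfolding sigma_def
  proof (rule free_endo_auto[OF f g], fold h_def k_def)
    fix j assume j: "j \<in> {1..n}"
    consider "j = i" | "j = i + 1" | "j \<noteq> i" "j \<noteq> i + 1" by blast
    then show "k (?f j) = gen j"
    proof cases
      case 3
      then show ?thesis using kgen[OF j] by simp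
    qed (use ab gv in \<open>simp_all add: F.m_assoc canc\<close>)
    consider "j = i" | "j = i + 1" | "j \<noteq> i" "j \<noteq> i + 1" by blast
    then show "h (?g j) = gen j"
    proof cases
      case 3
      then show ?thesis using hgen[OF j] by simp
    qed (use ab fv in \<open>simp_all add: F.m_assoc canc F.inv_mult_group\<close>)
  qed
qed
lemma LB_ext_generators_auto:
  "tau n ` {1..<n} \<union> sigma n ` {1..<n} \<union> rho n ` {1..n} \<subseteq> carrier (AutoGroup (free_group n))"
  using tau_auto sigma_auto rho_auto by (auto simp: AutoGroup_def)

lemma group_LB_ext: "group (LB_ext n)"
proof -
  interpret group "AutoGroup (free_group n)"
    by (rule group.AutoGroup[OF group_free_group])
  show ?thesis
    unfolding LB_ext_def
    by (rule subgroup.subgroup_is_group[OF generate_is_subgroup[OF LB_ext_generators_auto] group_axioms])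
qed

lemma group_LB: "group (LB n)"
proof -
  interpret group "AutoGroup (free_group n)"
    by (rule group.AutoGroup[OF group_free_group])
  have "tau n ` {1..<n} \<union> sigma n ` {1..<n} \<subseteq> carrier (AutoGroup (free_group n))"
    using LB_ext_generators_auto by blast
  then show ?thesis
    unfolding LB_def
    by (rule subgroup.subgroup_is_group[OF generate_is_subgroup group_axioms])
qed


section \<open>The rings of coefficients\<close>

text \<open>Laurent polynomials over the integers, as the group ring of the additive group of integers.
  The product on \<^type>\<open>poly_mapping\<close> is convolution.\<close>

type_synonym laurent = "int \<Rightarrow>\<^sub>0 int"

definition laurent_t :: laurent where
  "laurent_t = Poly_Mapping.single 1 1"

text \<open>The quotient of the Laurent polynomial ring by the principal ideal of \<open>t\<^sup>2 - 1\<close>.\<close>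

definition laurent_cong :: "laurent \<Rightarrow> laurent \<Rightarrow> bool" where
  "laurent_cong p q \<longleftrightarrow> laurent_t ^ 2 - 1 dvd p - q"

lemma equivp_laurent_cong: "equivp laurent_cong"
proof (rule equivpI)
  show "reflp laurent_cong" by (simp add: reflp_def laurent_cong_def)
  show "symp laurent_cong"
    unfolding symp_def laurent_cong_def by (metis dvd_minus_iff minus_diff_eq)
  show "transp laurent_cong"
  proof (rule transpI)
    fix p q r :: laurent
    assume "laurent_cong p q" "laurent_cong q r"
    then have "laurent_t ^ 2 - 1 dvd (p - q) + (q - r)"
      unfolding laurent_cong_def by (rule dvd_add)
    then show "laurent_cong p r"
      by (simp add: laurent_cong_def)
  qed
qed

quotient_type laurent_quot = laurent / laurent_cong
  morphisms laurent_rep laurent_proj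
  by (rule equivp_laurent_cong)

lemma lookup_t2_mult:
  fixes p :: laurent
  shows "poly_mapping.lookup (laurent_t ^ 2 * p) k = poly_mapping.lookup p (k - 2)"
proof -
  have t2: "laurent_t ^ 2 = Poly_Mapping.single 2 1"
    by (simp add: laurent_t_def power2_eq_square mult_single)
  have shift: "k = 2 + q \<longleftrightarrow> q = k - 2" for q :: int
    by auto
  have "poly_mapping.lookup (laurent_t ^ 2 * p) k =
      Sum_any (\<lambda>l. Sum_any (\<lambda>q. poly_mapping.lookup p q when k = 2 + q) when l = (2 :: int))"
    unfolding t2 lookup_mult by (intro Sum_any.cong) (auto simp: lookup_single when_def)
  also have "\<dots> = Sum_any (\<lambda>q. poly_mapping.lookup p q when q = k - 2)"
    by (simp add: shift)
  finally show ?thesis by simp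
qed

text \<open>The quotient is not the zero ring: substituting \<open>1\<close> for \<open>t\<close> kills \<open>t\<^sup>2 - 1\<close> but not \<open>1\<close>.\<close>

lemma t2_minus_1_not_dvd_1: "\<not> laurent_t ^ 2 - 1 dvd (1 :: laurent)"
proof
  assume "laurent_t ^ 2 - 1 dvd (1 :: laurent)"
  then obtain p where "(1 :: laurent) = (laurent_t ^ 2 - 1) * p" by (elim dvdE)
  then have "laurent_t ^ 2 * p = 1 + p"
    by (simp add: algebra_simps)
  then have shift: "poly_mapping.lookup p (k - 2) = (1 when k = 0) + poly_mapping.lookup p k" for k
    by (metis lookup_t2_mult lookup_add lookup_one)
  have bij: "bij (\<lambda>k :: int. k - 2)"
    by (rule o_bij[where g = "\<lambda>k. k + 2"]) (simp_all add: fun_eq_iff)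
  have "Sum_any (poly_mapping.lookup p) = Sum_any (\<lambda>k. poly_mapping.lookup p (k - 2))"
    by (rule Sum_any.reindex_cong[OF bij]) (simp add: fun_eq_iff)
  also have "\<dots> = Sum_any (\<lambda>k. (1 when k = 0) + poly_mapping.lookup p k)"
    by (simp only: shift)
  also have "\<dots> = Sum_any (\<lambda>k. (1 :: int) when k = (0 :: int)) + Sum_any (poly_mapping.lookup p)"
    by (rule Sum_any.distrib) (simp_all add: when_def)
  finally show False by simp
qed

instantiation laurent_quot :: comm_ring_1
begin

lift_definition zero_laurent_quot :: laurent_quot is "0" .
lift_definition one_laurent_quot :: laurent_quot is "1" .

lift_definition plus_laurent_quot :: "laurent_quot \<Rightarrow> laurent_quot \<Rightarrow> laurent_quot" is "(+)"
  unfolding laurent_cong_def by (metis add_diff_add dvd_add)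

lift_definition uminus_laurent_quot :: "laurent_quot \<Rightarrow> laurent_quot" is "uminus"
  unfolding laurent_cong_def by (metis dvd_minus_iff minus_diff_minus)

lift_definition minus_laurent_quot :: "laurent_quot \<Rightarrow> laurent_quot \<Rightarrow> laurent_quot" is "(-)"
proof -
  fix p p' q q' :: laurent
  assume "laurent_cong p p'" "laurent_cong q q'"
  then have "laurent_t ^ 2 - 1 dvd (p - p') - (q - q')"
    unfolding laurent_cong_def by (rule dvd_diff)
  then show "laurent_cong (p - q) (p' - q')"
    unfolding laurent_cong_def by (simp add: algebra_simps)
qed

lift_definition times_laurent_quot :: "laurent_quot \<Rightarrow> laurent_quot \<Rightarrow> laurent_quot" is "(*)"
proof -
  fix p p' q q' :: laurent
  assume "laurent_cong p p'" "laurent_cong q q'"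
  then have "laurent_t ^ 2 - 1 dvd (p - p') * q + p' * (q - q')"
    unfolding laurent_cong_def by (intro dvd_add dvd_mult dvd_mult2)
  then show "laurent_cong (p * q) (p' * q')"
    unfolding laurent_cong_def by (simp add: algebra_simps)
qed

instance
  by (intro_classes; transfer; auto simp: laurent_cong_def algebra_simps t2_minus_1_not_dvd_1)

end

definition quot_t :: laurent_quot where
  "quot_t = laurent_proj laurent_t"


section \<open>Burau matrices\<close>

definition GL :: "nat \<Rightarrow> 'a :: comm_ring_1 mat monoid" where
  "GL n = units_of (ring_mat TYPE('a) n ())"

definition tau_mat :: "nat \<Rightarrow> nat \<Rightarrow> 'a :: comm_ring_1 mat" where
  "tau_mat n i = diag_block_mat [1\<^sub>m (i - 1), mat_of_rows_list 2 [[0, 1], [1, 0]], 1\<^sub>m (n - i - 1)]"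

definition sigma_mat :: "'a \<Rightarrow> nat \<Rightarrow> nat \<Rightarrow> 'a :: comm_ring_1 mat" where
  "sigma_mat t n i =
     diag_block_mat [1\<^sub>m (i - 1), mat_of_rows_list 2 [[1 - t, 1], [t, 0]], 1\<^sub>m (n - i - 1)]"

definition rho_mat :: "'a \<Rightarrow> nat \<Rightarrow> nat \<Rightarrow> 'a :: comm_ring_1 mat" where
  "rho_mat t n i = diag_block_mat [1\<^sub>m (i - 1), mat_of_rows_list 1 [[- t]], 1\<^sub>m (n - i)]"

text \<open>Since the \<open>\<tau>\<^sub>i\<close> and \<open>\<sigma>\<^sub>i\<close> generate, this determines \<open>\<beta>\<close> on the carrier of \<open>LB n\<close>.\<close>

definition is_burau :: "nat \<Rightarrow> ((letter list \<Rightarrow> letter list) \<Rightarrow> laurent mat) \<Rightarrow> bool" where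
  "is_burau n \<beta> \<longleftrightarrow> \<beta> \<in> hom (LB n) (GL n) \<and>
     (\<forall>i\<in>{1..<n}. \<beta> (tau n i) = tau_mat n i \<and> \<beta> (sigma n i) = sigma_mat laurent_t n i)"

end

theory Submission
  imports Defs
begin

text \<open>The Burau matrices are Fox Jacobians. Give each generator \<open>a\<^sub>j\<close> an invertible weight \<open>t\<close> in a
  commutative ring, and let \<open>wt\<close> be the resulting character of the free group. The Fox derivative
  \<open>\<partial>\<^sub>k\<close>, with coefficients pushed forward along \<open>wt\<close>, is the crossed homomorphism determined by
  \<open>\<partial>\<^sub>k(u v) = \<partial>\<^sub>k u + wt u * \<partial>\<^sub>k v\<close> and \<open>\<partial>\<^sub>k a\<^sub>j = \<delta>\<^sub>j\<^sub>k\<close>. If an automorphism \<open>\<phi>\<close> preserves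
  \<open>wt\<close>, then \<open>w \<mapsto> \<partial>\<^sub>k(\<phi> w)\<close> is again a crossed homomorphism for \<open>wt\<close>, hence determined by its values
  on the \<open>a\<^sub>j\<close>; this is the chain rule (\<open>fox_chain_rule\<close>). It says that the matrix with
  columns \<open>(\<partial>\<^sub>k(\<phi> a\<^sub>j))\<^sub>k\<close> depends multiplicatively on \<open>\<phi>\<close>, so it gives a
  representation of every group of weight-preserving automorphisms (\<open>fox_mat_hom\<close>).

  The automorphisms \<open>\<tau>\<^sub>i\<close> and \<open>\<sigma>\<^sub>i\<close> send each generator to a conjugate of a generator, so they
  preserve \<open>wt\<close> for every invertible \<open>t\<close>; over the Laurent polynomials this constructs the Burau
  representation. The automorphism \<open>\<rho>\<^sub>i\<close> inverts \<open>a\<^sub>i\<close>, so it preserves \<open>wt\<close> exactly when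
  \<open>t = t\<^sup>-\<^sup>1\<close>. That is the relation imposed in the quotient by \<open>t\<^sup>2 - 1\<close>, where the same construction
  therefore applies to the whole extended group, and
  \<open>\<partial>\<^sub>i(a\<^sub>i\<^sup>-\<^sup>1) = - t\<^sup>-\<^sup>1 = - t\<close> is the entry claimed for \<open>\<rho>\<^sub>i\<close>. The two constructions match
  because a Fox derivative is a polynomial expression in \<open>t\<close> and \<open>t\<^sup>-\<^sup>1\<close>, hence commutes with the
  reduction of coefficients, and a Burau representation is determined by its values on
  generators (\<open>is_burau_unique\<close>).\<close>

section \<open>Words in the free group\<close>

lemma free_group_mult: "u \<otimes>\<^bsub>free_group n\<^esub> v = foldr cons_red u v"
  by (simp add: free_group_def)

lemma inv_gen:
  assumes "j \<in> {1..n}"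
  shows "inv\<^bsub>free_group n\<^esub> gen j = [(j, False)]"
proof (rule group.inv_equality[OF group_free_group])
  show "gen j \<in> carrier (free_group n)" by (rule gen_closed[OF assms])
qed (use assms in \<open>auto simp: free_group_def gen_def reduced_def\<close>)

lemma free_group_Cons:
  assumes "x # w \<in> carrier (free_group n)"
  shows "fst x \<in> {1..n}" "[x] \<in> carrier (free_group n)" "w \<in> carrier (free_group n)"
    "x # w = [x] \<otimes>\<^bsub>free_group n\<^esub> w"
  using assms by (auto simp: free_group_def cons_red_reduced dest: reduced_tl) (simp add: reduced_def)

lemma letter_word_cases:
  assumes "fst x \<in> {1..n}"
  obtains (pos) "snd x" "[x] = gen (fst x)"
    | (neg) "\<not> snd x" "[x] = inv\<^bsub>free_group n\<^esub> gen (fst x)"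
  using inv_gen[OF assms] by (cases x, cases "snd x") (auto simp: gen_def)


section \<open>Fox derivatives with coefficients in a commutative ring\<close>

text \<open>The inverse \<open>s\<close> of \<open>t\<close> is a parameter of its own, since \<open>t\<close> is a unit of a ring that need not be
  a field.\<close>

locale fox_weights =
  fixes t s :: "'a :: comm_ring_1"
  assumes t_s: "t * s = 1"
begin

definition letter_wt :: "letter \<Rightarrow> 'a" where
  "letter_wt x = (if snd x then t else s)"

definition wt :: "letter list \<Rightarrow> 'a" where
  "wt w = prod_list (map letter_wt w)"

definition letter_fox :: "nat \<Rightarrow> letter \<Rightarrow> 'a" where
  "letter_fox k x = (if fst x = k then if snd x then 1 else - s else 0)"

fun fox :: "nat \<Rightarrow> letter list \<Rightarrow> 'a" where
  "fox k [] = 0"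
| "fox k (x # w) = letter_fox k x + letter_wt x * fox k w"

text \<open>The next two identities say that a cancelling pair of letters has weight one and derivative
  zero. This is why weights and derivatives, defined letter by letter, are compatible with the
  free reduction performed by \<^const>\<open>cons_red\<close>.\<close>

lemma letter_wt_inv: "letter_wt x * letter_wt (inv_letter x) = 1"
  using t_s by (simp add: letter_wt_def mult.commute)

lemma letter_fox_inv: "letter_fox k x + letter_wt x * letter_fox k (inv_letter x) = 0"
  using t_s by (simp add: letter_wt_def letter_fox_def)

lemma wt_cons_red: "wt (cons_red x w) = letter_wt x * wt w"
proof (cases w)
  case (Cons y w')
  have "letter_wt x * (letter_wt (inv_letter x) * wt w') = wt w'"
    by (simp add: mult.assoc[symmetric] letter_wt_inv)
  then show ?thesis using Cons by (simp add: wt_def)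
qed (simp add: wt_def)

lemma fox_cons_red: "fox k (cons_red x w) = letter_fox k x + letter_wt x * fox k w"
proof (cases w)
  case (Cons y w')
  have "letter_fox k x + letter_wt x * (letter_fox k (inv_letter x) + letter_wt (inv_letter x) * fox k w')
      = (letter_fox k x + letter_wt x * letter_fox k (inv_letter x))
        + letter_wt x * letter_wt (inv_letter x) * fox k w'"
    by (simp add: algebra_simps)
  also have "\<dots> = fox k w'"
    by (simp add: letter_wt_inv letter_fox_inv)
  finally show ?thesis using Cons by simp
qed simp

lemma wt_mult: "wt (u \<otimes>\<^bsub>free_group n\<^esub> v) = wt u * wt v"
  unfolding free_group_mult by (induction u) (simp_all add: wt_cons_red, simp_all add: wt_def)

lemma fox_mult: "fox k (u \<otimes>\<^bsub>free_group n\<^esub> v) = fox k u + wt u * fox k v"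
  unfolding free_group_mult
  by (induction u) (simp_all add: fox_cons_red wt_def algebra_simps)

lemma wt_one [simp]: "wt (\<one>\<^bsub>free_group n\<^esub>) = 1"
  by (simp add: free_group_def wt_def)

lemma fox_one [simp]: "fox k (\<one>\<^bsub>free_group n\<^esub>) = 0"
  by (simp add: free_group_def)

lemma wt_gen [simp]: "wt (gen j) = t" and fox_gen [simp]: "fox k (gen j) = (if j = k then 1 else 0)"
  by (simp_all add: wt_def gen_def letter_wt_def letter_fox_def)

lemma wt_inv:
  assumes "w \<in> carrier (free_group n)" "wt w = t"
  shows "wt (inv\<^bsub>free_group n\<^esub> w) = s"
proof -
  have "wt (inv\<^bsub>free_group n\<^esub> w) * t = 1"
    using wt_mult[of n "inv\<^bsub>free_group n\<^esub> w" w] assms group.l_inv[OF group_free_group assms(1)] by simp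
  then have "wt (inv\<^bsub>free_group n\<^esub> w) * (t * s) = s"
    by (simp add: mult.assoc[symmetric])
  then show ?thesis using t_s by simp
qed

lemma fox_inv:
  assumes "w \<in> carrier (free_group n)" "wt w = t"
  shows "fox k (inv\<^bsub>free_group n\<^esub> w) = - (s * fox k w)"
  using fox_mult[of k n "inv\<^bsub>free_group n\<^esub> w" w] group.l_inv[OF group_free_group assms(1)]
  by (simp add: wt_inv[OF assms] eq_neg_iff_add_eq_0)


section \<open>The chain rule\<close>

definition preserves_wt :: "nat \<Rightarrow> (letter list \<Rightarrow> letter list) \<Rightarrow> bool" where
  "preserves_wt n \<phi> \<longleftrightarrow> (\<forall>w\<in>carrier (free_group n). wt (\<phi> w) = wt w)"

lemma preserves_wtI:
  assumes hom: "\<phi> \<in> hom (free_group n) (free_group n)"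
    and gen: "\<And>j. j \<in> {1..n} \<Longrightarrow> wt (\<phi> (gen j)) = t"
  shows "preserves_wt n \<phi>"
  unfolding preserves_wt_def
proof
  interpret \<phi>: group_hom "free_group n" "free_group n" \<phi>
    by (intro group_hom.intro group_hom_axioms.intro group_free_group hom)
  fix w
  show "w \<in> carrier (free_group n) \<Longrightarrow> wt (\<phi> w) = wt w"
  proof (induction w)
    case Nil
    show ?case using \<phi>.hom_one wt_one[of n] by (simp add: free_group_def)
  next
    case (Cons x w)
    note x = free_group_Cons[OF Cons.prems]
    note g = gen_closed[OF x(1)]
    have "wt (\<phi> [x]) = wt [x]"
    proof (cases rule: letter_word_cases[OF x(1)])
      case 1
      then show ?thesis using gen[OF x(1)] by simp
    next
      case 2
      then show ?thesis using gen[OF x(1)] g by (simp add: wt_inv)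
    qed
    then show ?case
      using x Cons.IH by (simp add: wt_mult)
  qed
qed

text \<open>Both sides are crossed homomorphisms in \<open>w\<close> for the character \<open>wt\<close>, on the left because \<open>\<phi>\<close>
  preserves weights, and they agree on the generators. In the induction on the word, the case of an
  inverse letter reduces to that of a generator by the rule for the derivative of an inverse.\<close>

lemma fox_chain_rule:
  assumes hom: "\<phi> \<in> hom (free_group n) (free_group n)" and pres: "preserves_wt n \<phi>"
    and w: "w \<in> carrier (free_group n)"
  shows "fox k (\<phi> w) = (\<Sum>j\<in>{1..n}. fox k (\<phi> (gen j)) * fox j w)"
  using w
proof (induction w)
  interpret \<phi>: group_hom "free_group n" "free_group n" \<phi>
    by (intro group_hom.intro group_hom_axioms.intro group_free_group hom)
  {
    case Nil
    show ?case using \<phi>.hom_one fox_one[of k n] by (simp add: free_group_def)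
  next
    case (Cons x w)
    note x = free_group_Cons[OF Cons.prems]
    note g = gen_closed[OF x(1)]
    have wt_\<phi>: "wt (\<phi> v) = wt v" if "v \<in> carrier (free_group n)" for v
      using pres that by (simp add: preserves_wt_def)
    have "fox k (\<phi> [x]) = letter_fox (fst x) x * fox k (\<phi> (gen (fst x)))"
    proof (cases rule: letter_word_cases[OF x(1)])
      case 1
      then show ?thesis by (simp add: letter_fox_def)
    next
      case 2
      then show ?thesis using g wt_\<phi>[OF g] by (simp add: fox_inv letter_fox_def)
    qed
    also have "\<dots> = (\<Sum>j\<in>{1..n}. if fst x = j then fox k (\<phi> (gen j)) * letter_fox j x else 0)"
      using x(1) by (simp add: mult.commute)
    also have "\<dots> = (\<Sum>j\<in>{1..n}. fox k (\<phi> (gen j)) * fox j [x])"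
      by (intro sum.cong) (auto simp: letter_fox_def)
    finally have single: "fox k (\<phi> [x]) = (\<Sum>j\<in>{1..n}. fox k (\<phi> (gen j)) * fox j [x])" .
    have "fox k (\<phi> (x # w)) = fox k (\<phi> [x]) + wt [x] * fox k (\<phi> w)"
      using x(2,3) wt_\<phi>[OF x(2)] by (subst x(4)) (simp add: fox_mult)
    also have "\<dots> = (\<Sum>j\<in>{1..n}. fox k (\<phi> (gen j)) * (fox j [x] + wt [x] * fox j w))"
      unfolding single Cons.IH[OF x(3)] sum_distrib_left sum.distrib[symmetric]
      by (intro sum.cong) (simp_all add: algebra_simps)
    finally show ?case by (simp add: wt_def)
  }
qed

text \<open>The transpose of the usual Jacobian: column \<open>c\<close> holds the derivatives of the image of one
  generator. With matrices acting on columns and automorphisms composed from right to left, this is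
  the convention that gives a homomorphism rather than an antihomomorphism. Matrix indices start
  at \<open>0\<close>, generators at \<open>1\<close>.\<close>

definition fox_mat :: "nat \<Rightarrow> (letter list \<Rightarrow> letter list) \<Rightarrow> 'a mat" where
  "fox_mat n \<phi> = mat n n (\<lambda>(r, c). fox (Suc r) (\<phi> (gen (Suc c))))"

lemma fox_mat_carrier [simp]: "fox_mat n \<phi> \<in> carrier_mat n n"
  by (simp add: fox_mat_def)

lemma fox_mat_compose:
  assumes "\<phi> \<in> hom (free_group n) (free_group n)" "preserves_wt n \<phi>"
    and \<psi>: "\<psi> \<in> hom (free_group n) (free_group n)"
  shows "fox_mat n (compose (carrier (free_group n)) \<phi> \<psi>) = fox_mat n \<phi> * fox_mat n \<psi>"
proof (rule eq_matI)
  fix r c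
  assume "r < dim_row (fox_mat n \<phi> * fox_mat n \<psi>)" "c < dim_col (fox_mat n \<phi> * fox_mat n \<psi>)"
  then have rc: "r < n" "c < n" by (simp_all add: fox_mat_def)
  then have g: "gen (Suc c) \<in> carrier (free_group n)" by (simp add: gen_closed)
  then have "\<psi> (gen (Suc c)) \<in> carrier (free_group n)"
    using \<psi> by (auto simp: hom_def)
  note chain = fox_chain_rule[OF assms(1,2) this]
  have "(\<Sum>j\<in>{1..n}. f j) = (\<Sum>j<n. f (Suc j))" for f :: "nat \<Rightarrow> 'a"
    using sum.atLeast1_atMost_eq[of f n] by simp
  then show "fox_mat n (compose (carrier (free_group n)) \<phi> \<psi>) $$ (r, c) = (fox_mat n \<phi> * fox_mat n \<psi>) $$ (r, c)"
    using rc g by (simp add: fox_mat_def compose_eq chain scalar_prod_def atLeast0LessThan)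
qed (simp_all add: fox_mat_def)

lemma fox_mat_id: "fox_mat n (\<lambda>w\<in>carrier (free_group n). w) = 1\<^sub>m n"
  by (rule eq_matI) (auto simp: fox_mat_def gen_closed)


section \<open>The representation\<close>

definition wt_autos :: "nat \<Rightarrow> (letter list \<Rightarrow> letter list) set" where
  "wt_autos n = {\<phi> \<in> auto (free_group n). preserves_wt n \<phi>}"

lemma AutoGroup_simps:
  "carrier (AutoGroup G) = auto G"
  "\<one>\<^bsub>AutoGroup G\<^esub> = (\<lambda>w\<in>carrier G. w)"
  "\<phi> \<in> auto G \<Longrightarrow> \<psi> \<in> auto G \<Longrightarrow> \<phi> \<otimes>\<^bsub>AutoGroup G\<^esub> \<psi> = compose (carrier G) \<phi> \<psi>"
  by (simp_all add: AutoGroup_def BijGroup_def auto_def)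

lemma subgroup_wt_autos: "subgroup (wt_autos n) (AutoGroup (free_group n))"
proof -
  interpret group "AutoGroup (free_group n)"
    by (rule group.AutoGroup[OF group_free_group])
  have ap: "\<phi> w \<in> carrier (free_group n)"
    if "\<phi> \<in> auto (free_group n)" "w \<in> carrier (free_group n)" for \<phi> w
    using that by (auto simp: auto_def hom_def)
  show ?thesis
  proof (rule subgroupI)
    show "wt_autos n \<subseteq> carrier (AutoGroup (free_group n))"
      by (auto simp: wt_autos_def AutoGroup_simps)
    show "wt_autos n \<noteq> {}"
      using group.id_in_auto[OF group_free_group, of n]
      by (auto simp: wt_autos_def preserves_wt_def)
  next
    fix \<phi> assume \<phi>: "\<phi> \<in> wt_autos n"
    let ?\<psi> = "inv\<^bsub>AutoGroup (free_group n)\<^esub> \<phi>"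
    have a: "\<phi> \<in> auto (free_group n)" "?\<psi> \<in> auto (free_group n)"
      using \<phi> inv_closed[of \<phi>] by (auto simp: wt_autos_def AutoGroup_simps)
    have cmp: "compose (carrier (free_group n)) \<phi> ?\<psi> = (\<lambda>w\<in>carrier (free_group n). w)"
      using r_inv[of \<phi>] a by (simp add: AutoGroup_simps)
    have "\<phi> (?\<psi> w) = w" if "w \<in> carrier (free_group n)" for w
      using that fun_cong[OF cmp, of w] by (simp add: compose_eq)
    moreover have "wt (\<phi> (?\<psi> w)) = wt (?\<psi> w)" if "w \<in> carrier (free_group n)" for w
      using \<phi> ap[OF a(2) that] by (simp add: wt_autos_def preserves_wt_def)
    ultimately show "?\<psi> \<in> wt_autos n"
      using a by (simp add: wt_autos_def preserves_wt_def)
  next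
    fix \<phi> \<psi> assume "\<phi> \<in> wt_autos n" "\<psi> \<in> wt_autos n"
    moreover from this have "\<phi> \<otimes>\<^bsub>AutoGroup (free_group n)\<^esub> \<psi> \<in> auto (free_group n)"
      using m_closed[of \<phi> \<psi>] by (simp add: wt_autos_def AutoGroup_simps)
    ultimately show "\<phi> \<otimes>\<^bsub>AutoGroup (free_group n)\<^esub> \<psi> \<in> wt_autos n"
      using ap by (simp add: wt_autos_def preserves_wt_def AutoGroup_simps compose_eq)
  qed
qed

lemma fox_mat_mult:
  assumes "\<phi> \<in> wt_autos n" "\<psi> \<in> wt_autos n"
  shows "fox_mat n (\<phi> \<otimes>\<^bsub>AutoGroup (free_group n)\<^esub> \<psi>) = fox_mat n \<phi> * fox_mat n \<psi>"
  using assms by (simp add: wt_autos_def AutoGroup_simps fox_mat_compose auto_def)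

text \<open>The matrices are invertible because the inverse automorphism also preserves weights, and
  multiplicativity makes its matrix the inverse one.\<close>

lemma fox_mat_hom:
  assumes "H \<subseteq> wt_autos n"
    and sub: "subgroup H (AutoGroup (free_group n))"
  shows "fox_mat n \<in> hom ((AutoGroup (free_group n))\<lparr>carrier := H\<rparr>) (GL n)"
proof (rule homI)
  interpret group "AutoGroup (free_group n)"
    by (rule group.AutoGroup[OF group_free_group])
  fix \<phi> assume "\<phi> \<in> carrier ((AutoGroup (free_group n))\<lparr>carrier := H\<rparr>)"
  then have H: "\<phi> \<in> H" "inv\<^bsub>AutoGroup (free_group n)\<^esub> \<phi> \<in> H"
    using subgroup.m_inv_closed[OF sub] by simp_all
  then have \<phi>: "\<phi> \<in> wt_autos n" "inv\<^bsub>AutoGroup (free_group n)\<^esub> \<phi> \<in> wt_autos n"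
    using assms by blast+
  have "\<phi> \<in> carrier (AutoGroup (free_group n))"
    using H sub subgroup.mem_carrier by metis
  then have "fox_mat n \<phi> * fox_mat n (inv\<^bsub>AutoGroup (free_group n)\<^esub> \<phi>) = 1\<^sub>m n"
    "fox_mat n (inv\<^bsub>AutoGroup (free_group n)\<^esub> \<phi>) * fox_mat n \<phi> = 1\<^sub>m n"
    using fox_mat_mult[OF \<phi>(1,2)] fox_mat_mult[OF \<phi>(2,1)]
    by (simp_all add: AutoGroup_simps(2) fox_mat_id)
  then show "fox_mat n \<phi> \<in> carrier (GL n)"
    unfolding GL_def units_of_carrier Units_def
    by (auto simp: ring_mat_simps intro!: bexI[of _ "fox_mat n (inv\<^bsub>AutoGroup (free_group n)\<^esub> \<phi>)"])
  fix \<psi> assume "\<psi> \<in> carrier ((AutoGroup (free_group n))\<lparr>carrier := H\<rparr>)"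
  then show "fox_mat n (\<phi> \<otimes>\<^bsub>(AutoGroup (free_group n))\<lparr>carrier := H\<rparr>\<^esub> \<psi>)
      = fox_mat n \<phi> \<otimes>\<^bsub>GL n\<^esub> fox_mat n \<psi>"
    using fox_mat_mult[of \<phi> n \<psi>] assms \<phi> by (auto simp: GL_def units_of_mult ring_mat_simps)
qed


section \<open>Values on the generators\<close>

lemma free_endo_preserves_wt:
  assumes f: "f \<in> {1..n} \<rightarrow> carrier (free_group n)" and "\<And>j. j \<in> {1..n} \<Longrightarrow> wt (f j) = t"
  shows "preserves_wt n (free_endo n f)"
  by (rule preserves_wtI[OF free_endo_hom[OF f]]) (simp add: assms free_endo_gen[OF f])

lemma fox_mat_free_endo:
  assumes "f \<in> {1..n} \<rightarrow> carrier (free_group n)"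
  shows "fox_mat n (free_endo n f) = mat n n (\<lambda>(r, c). fox (Suc r) (f (Suc c)))"
  by (rule eq_matI) (simp_all add: fox_mat_def free_endo_gen[OF assms])

end

text \<open>Turning the block matrices into entrywise formulas makes them comparable with Jacobians.\<close>

lemma diag_block_one_mat:
  assumes "B \<in> carrier_mat b b"
  shows "diag_block_mat [1\<^sub>m p, B, 1\<^sub>m q] = mat (p + b + q) (p + b + q)
    (\<lambda>(r, c). if r \<in> {p..<p + b} \<and> c \<in> {p..<p + b} then B $$ (r - p, c - p) else if r = c then 1 else 0)"
  using assms by (intro eq_matI) (auto simp: Let_def)

lemma tau_mat_entries:
  assumes "i \<in> {1..<n}"
  shows "tau_mat n i = mat n n (\<lambda>(r, c).
    if Suc c = i then if Suc r = i + 1 then 1 else 0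
    else if Suc c = i + 1 then if Suc r = i then 1 else 0
    else if r = c then 1 else 0)"
proof -
  obtain p q where pq: "i = Suc p" "n = p + 2 + q"
  proof (rule that)
    show "i = Suc (i - 1)" "n = i - 1 + 2 + (n - i - 1)"
      using assms by auto
  qed
  let ?B = "mat_of_rows_list 2 [[0, 1], [1, 0]]"
  have B: "?B \<in> carrier_mat 2 2"
    by (rule carrier_matI) (simp_all add: mat_of_rows_list_def)
  have "tau_mat n i = diag_block_mat [1\<^sub>m p, ?B, 1\<^sub>m q]"
    by (simp add: tau_mat_def pq)
  also have "\<dots> = mat n n (\<lambda>(r, c).
      if r \<in> {p..<p + 2} \<and> c \<in> {p..<p + 2} then ?B $$ (r - p, c - p) else if r = c then 1 else 0)"
    unfolding pq(2) by (rule diag_block_one_mat[OF B])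
  also have "\<dots> = mat n n (\<lambda>(r, c). if Suc c = i then if Suc r = i + 1 then 1 else 0
    else if Suc c = i + 1 then if Suc r = i then 1 else 0
    else if r = c then 1 else 0)"
  proof (rule cong_mat)
    fix r c
    have "x < p \<or> x = p \<or> x = Suc p \<or> Suc p < x" for x
      by linarith
    from this[of r] this[of c] show "(case (r, c) of (r, c) \<Rightarrow>
        if r \<in> {p..<p + 2} \<and> c \<in> {p..<p + 2} then ?B $$ (r - p, c - p) else if r = c then 1 else 0)
      = (case (r, c) of (r, c) \<Rightarrow> if Suc c = i then if Suc r = i + 1 then 1 else 0
    else if Suc c = i + 1 then if Suc r = i then 1 else 0
    else if r = c then 1 else 0)"
      by (elim disjE) (simp_all add: pq(1) mat_of_rows_list_def)
  qed simp_all
  finally show ?thesis .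
qed

lemma sigma_mat_entries:
  assumes "i \<in> {1..<n}"
  shows "sigma_mat t n i = mat n n (\<lambda>(r, c).
    if Suc c = i then if Suc r = i then 1 - t else if Suc r = i + 1 then t else 0
    else if Suc c = i + 1 then if Suc r = i then 1 else 0
    else if r = c then 1 else 0)"
proof -
  obtain p q where pq: "i = Suc p" "n = p + 2 + q"
  proof (rule that)
    show "i = Suc (i - 1)" "n = i - 1 + 2 + (n - i - 1)"
      using assms by auto
  qed
  let ?B = "mat_of_rows_list 2 [[1 - t, 1], [t, 0]]"
  have B: "?B \<in> carrier_mat 2 2"
    by (rule carrier_matI) (simp_all add: mat_of_rows_list_def)
  have "sigma_mat t n i = diag_block_mat [1\<^sub>m p, ?B, 1\<^sub>m q]"
    by (simp add: sigma_mat_def pq)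
  also have "\<dots> = mat n n (\<lambda>(r, c).
      if r \<in> {p..<p + 2} \<and> c \<in> {p..<p + 2} then ?B $$ (r - p, c - p) else if r = c then 1 else 0)"
    unfolding pq(2) by (rule diag_block_one_mat[OF B])
  also have "\<dots> = mat n n (\<lambda>(r, c). if Suc c = i then if Suc r = i then 1 - t else if Suc r = i + 1 then t else 0
    else if Suc c = i + 1 then if Suc r = i then 1 else 0
    else if r = c then 1 else 0)"
  proof (rule cong_mat)
    fix r c
    have "x < p \<or> x = p \<or> x = Suc p \<or> Suc p < x" for x
      by linarith
    from this[of r] this[of c] show "(case (r, c) of (r, c) \<Rightarrow>
        if r \<in> {p..<p + 2} \<and> c \<in> {p..<p + 2} then ?B $$ (r - p, c - p) else if r = c then 1 else 0)
      = (case (r, c) of (r, c) \<Rightarrow> if Suc c = i then if Suc r = i then 1 - t else if Suc r = i + 1 then t else 0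
    else if Suc c = i + 1 then if Suc r = i then 1 else 0
    else if r = c then 1 else 0)"
      by (elim disjE) (simp_all add: pq(1) mat_of_rows_list_def)
  qed simp_all
  finally show ?thesis .
qed

lemma rho_mat_entries:
  assumes "i \<in> {1..n}"
  shows "rho_mat t n i = mat n n (\<lambda>(r, c). if r = c then if Suc c = i then - t else 1 else 0)"
proof -
  obtain p q where pq: "i = Suc p" "n = p + 1 + q"
  proof (rule that)
    show "i = Suc (i - 1)" "n = i - 1 + 1 + (n - i)"
      using assms by auto
  qed
  let ?B = "mat_of_rows_list 1 [[- t]]"
  have B: "?B \<in> carrier_mat 1 1"
    by (rule carrier_matI) (simp_all add: mat_of_rows_list_def)
  have "rho_mat t n i = diag_block_mat [1\<^sub>m p, ?B, 1\<^sub>m q]"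
    by (simp add: rho_mat_def pq)
  also have "\<dots> = mat n n (\<lambda>(r, c).
      if r \<in> {p..<p + 1} \<and> c \<in> {p..<p + 1} then ?B $$ (r - p, c - p) else if r = c then 1 else 0)"
    unfolding pq(2) by (rule diag_block_one_mat[OF B])
  also have "\<dots> = mat n n (\<lambda>(r, c). if r = c then if Suc c = i then - t else 1 else 0)"
    by (rule cong_mat) (auto simp: pq(1) mat_of_rows_list_def)
  finally show ?thesis .
qed

context fox_weights
begin

lemma tau_values:
  assumes i: "i \<in> {1..<n}"
  shows "tau n i \<in> wt_autos n" "fox_mat n (tau n i) = tau_mat n i"
proof -
  let ?f = "gen(i := gen (i + 1), i + 1 := gen i)"
  have f: "?f \<in> {1..n} \<rightarrow> carrier (free_group n)"
    using i by (auto intro!: gen_closed)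
  show "tau n i \<in> wt_autos n"
    using tau_auto[OF i] free_endo_preserves_wt[OF f] by (simp add: wt_autos_def tau_def)
  show "fox_mat n (tau n i) = tau_mat n i"
    unfolding tau_def fox_mat_free_endo[OF f] tau_mat_entries[OF i]
    by (rule eq_matI) auto
qed

lemma sigma_values:
  assumes i: "i \<in> {1..<n}"
  shows "sigma n i \<in> wt_autos n" "fox_mat n (sigma n i) = sigma_mat t n i"
proof -
  interpret F: group "free_group n" by (rule group_free_group)
  define c where "c = gen i \<otimes>\<^bsub>free_group n\<^esub> gen (i + 1) \<otimes>\<^bsub>free_group n\<^esub> inv\<^bsub>free_group n\<^esub> gen i"
  let ?f = "gen(i := c, i + 1 := gen i)"
  have g: "gen i \<in> carrier (free_group n)" "gen (i + 1) \<in> carrier (free_group n)"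
    using i by (auto intro!: gen_closed)
  then have f: "?f \<in> {1..n} \<rightarrow> carrier (free_group n)"
    by (auto simp: c_def intro!: gen_closed)
  have wt: "wt c = t"
    using g t_s by (simp add: c_def wt_mult wt_inv mult.assoc)
  have fox: "fox k c = (if k = i then 1 - t else if k = i + 1 then t else 0)" for k
  proof -
    (* One term for each factor of the conjugate. The last factor has derivative - s and is
       preceded by two generators, of total weight t * t. *)
    have "fox k c = (if i = k then 1 else 0) + t * (if i + 1 = k then 1 else 0)
        - t * (t * s) * (if i = k then 1 else 0)"
      using g by (simp add: c_def wt_mult fox_mult fox_inv mult.assoc)
    then show ?thesis by (auto simp: t_s)
  qed
  have sigma: "sigma n i = free_endo n ?f"
    by (simp add: sigma_def c_def)
  show "sigma n i \<in> wt_autos n"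
    using sigma_auto[OF i] free_endo_preserves_wt[OF f] wt by (simp add: wt_autos_def sigma)
  show "fox_mat n (sigma n i) = sigma_mat t n i"
    unfolding sigma fox_mat_free_endo[OF f] sigma_mat_entries[OF i]
    by (rule eq_matI) (auto simp: fox)
qed

text \<open>Here \<open>s = t\<close> enters: the inverted generator has weight \<open>s\<close>, so weights are preserved only if
  \<open>t\<close> is its own inverse.\<close>

lemma rho_values:
  assumes s: "s = t" and i: "i \<in> {1..n}"
  shows "rho n i \<in> wt_autos n" "fox_mat n (rho n i) = rho_mat t n i"
proof -
  interpret F: group "free_group n" by (rule group_free_group)
  let ?f = "gen(i := inv\<^bsub>free_group n\<^esub> gen i)"
  have g: "gen i \<in> carrier (free_group n)" by (rule gen_closed[OF i])
  then have f: "?f \<in> {1..n} \<rightarrow> carrier (free_group n)"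
    by (auto intro!: gen_closed)
  have wt: "wt (inv\<^bsub>free_group n\<^esub> gen i) = t"
    using wt_inv[OF g wt_gen] s by (rule trans)
  have fox: "fox k (inv\<^bsub>free_group n\<^esub> gen i) = (if k = i then - s else 0)" for k
    using g by (auto simp: fox_inv)
  show "rho n i \<in> wt_autos n"
    using rho_auto[OF i] free_endo_preserves_wt[OF f] wt
    by (simp add: wt_autos_def rho_def)
  show "fox_mat n (rho n i) = rho_mat t n i"
    unfolding rho_def fox_mat_free_endo[OF f] rho_mat_entries[OF i]
    by (rule eq_matI) (auto simp: fox intro: s)
qed

lemma fox_mat_hom_generate:
  assumes "S \<subseteq> wt_autos n"
  shows "fox_mat n \<in> hom
    ((AutoGroup (free_group n))\<lparr>carrier := generate (AutoGroup (free_group n)) S\<rparr>) (GL n)"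
proof -
  interpret group "AutoGroup (free_group n)"
    by (rule group.AutoGroup[OF group_free_group])
  have "S \<subseteq> carrier (AutoGroup (free_group n))"
    using assms subgroup.subset[OF subgroup_wt_autos] by blast
  then show ?thesis
    using generate_subgroup_incl[OF assms subgroup_wt_autos]
    by (intro fox_mat_hom generate_is_subgroup)
qed

lemma fox_mat_hom_LB: "fox_mat n \<in> hom (LB n) (GL n)"
  unfolding LB_def by (rule fox_mat_hom_generate) (use tau_values(1) sigma_values(1) in blast)

lemma fox_mat_hom_LB_ext:
  assumes "s = t"
  shows "fox_mat n \<in> hom (LB_ext n) (GL n)"
  unfolding LB_ext_def
  by (rule fox_mat_hom_generate) (use tau_values(1) sigma_values(1) rho_values(1)[OF assms] in blast)

end


section \<open>Uniqueness and change of coefficients\<close>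

lemma (in group) hom_eq_on_generate:
  assumes "group H" and S: "S \<subseteq> carrier G"
    and h: "h \<in> hom (G\<lparr>carrier := generate G S\<rparr>) H"
    and k: "k \<in> hom (G\<lparr>carrier := generate G S\<rparr>) H"
    and eq: "\<And>x. x \<in> S \<Longrightarrow> h x = k x"
    and x: "x \<in> generate G S"
  shows "h x = k x"
proof -
  let ?G = "G\<lparr>carrier := generate G S\<rparr>"
  have sub: "subgroup (generate G S) G" by (rule generate_is_subgroup[OF S])
  then have "group ?G" by (rule subgroup.subgroup_is_group) (rule group_axioms)
  then interpret h: group_hom ?G H h + k: group_hom ?G H k
    using assms by (simp_all add: group_hom_def group_hom_axioms_def)
  show ?thesis
    using x
  proof (induction rule: generate.induct)
    case one
    then show ?case using h.hom_one k.hom_one by simp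
  next
    case (incl x)
    then show ?case by (rule eq)
  next
    case (inv x)
    then have "x \<in> generate G S" by (rule generate.incl)
    then show ?case
      using h.hom_inv[of x] k.hom_inv[of x] eq[OF inv] m_inv_consistent[OF sub] by simp
  next
    case (eng x y)
    then show ?case using h.hom_mult[of x y] k.hom_mult[of x y] by simp
  qed
qed

lemma group_GL: "group (GL n :: 'a :: comm_ring_1 mat monoid)"
proof -
  interpret ring "ring_mat TYPE('a) n ()" by (rule ring_mat)
  show ?thesis unfolding GL_def by (rule units_group)
qed

lemma laurent_t_inverse: "laurent_t * Poly_Mapping.single (- 1) 1 = 1"
  by (simp add: laurent_t_def mult_single)

text \<open>The Laurent polynomials give \<open>R\<close>, and the quotient, where \<open>t\<close> is its own inverse, gives \<open>S\<close>.\<close>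

interpretation R: fox_weights laurent_t "Poly_Mapping.single (- 1) 1"
  by unfold_locales (rule laurent_t_inverse)

lemma quot_t_square: "quot_t * quot_t = 1"
  unfolding quot_t_def
  by transfer (simp add: laurent_cong_def power2_eq_square)

interpretation S: fox_weights quot_t quot_t
  by unfold_locales (rule quot_t_square)

lemma laurent_proj_hom:
  "laurent_proj 0 = 0" "laurent_proj 1 = 1" "laurent_proj (- p) = - laurent_proj p"
  "laurent_proj (p + q) = laurent_proj p + laurent_proj q"
  "laurent_proj (p * q) = laurent_proj p * laurent_proj q"
  by (simp_all add: zero_laurent_quot.abs_eq one_laurent_quot.abs_eq uminus_laurent_quot.abs_eq
      plus_laurent_quot.abs_eq times_laurent_quot.abs_eq)

text \<open>The projection carries the weights of \<open>R\<close> to those of \<open>S\<close>, by uniqueness of inverses.\<close>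

lemma laurent_proj_inverse: "laurent_proj (Poly_Mapping.single (- 1) 1) = quot_t"
proof -
  have "quot_t * laurent_proj (Poly_Mapping.single (- 1) 1) = 1"
    unfolding quot_t_def laurent_proj_hom(2,5)[symmetric] laurent_t_inverse ..
  then have "quot_t * quot_t * laurent_proj (Poly_Mapping.single (- 1) 1) = quot_t"
    by (simp add: mult.assoc)
  then show ?thesis by (simp add: quot_t_square)
qed

lemma laurent_proj_fox: "laurent_proj (R.fox k w) = S.fox k w"
  by (induction w)
    (simp_all add: laurent_proj_hom laurent_proj_inverse R.letter_fox_def S.letter_fox_def
      R.letter_wt_def S.letter_wt_def quot_t_def[symmetric])

lemma map_laurent_proj_fox_mat: "map_mat laurent_proj (R.fox_mat n \<phi>) = S.fox_mat n \<phi>"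
  by (rule eq_matI) (simp_all add: R.fox_mat_def S.fox_mat_def laurent_proj_fox)

lemma is_burau_fox_mat: "is_burau n (R.fox_mat n)"
  by (simp add: is_burau_def R.fox_mat_hom_LB R.tau_values R.sigma_values)

lemma is_burau_unique:
  assumes "is_burau n \<beta>" "is_burau n \<gamma>" "g \<in> carrier (LB n)"
  shows "\<beta> g = \<gamma> g"
proof -
  interpret group "AutoGroup (free_group n)"
    by (rule group.AutoGroup[OF group_free_group])
  let ?S = "tau n ` {1..<n} \<union> sigma n ` {1..<n}"
  show ?thesis
  proof (rule hom_eq_on_generate[OF group_GL, where S = ?S and h = \<beta> and k = \<gamma>])
    show "?S \<subseteq> carrier (AutoGroup (free_group n))"
      using LB_ext_generators_auto by blast
    show "\<beta> \<in> hom ((AutoGroup (free_group n))\<lparr>carrier := generate (AutoGroup (free_group n)) ?S\<rparr>) (GL n)"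
      "\<gamma> \<in> hom ((AutoGroup (free_group n))\<lparr>carrier := generate (AutoGroup (free_group n)) ?S\<rparr>) (GL n)"
      "g \<in> generate (AutoGroup (free_group n)) ?S"
      using assms by (simp_all add: is_burau_def LB_def)
    show "\<beta> x = \<gamma> x" if "x \<in> ?S" for x
      using assms(1,2) that by (auto simp: is_burau_def)
  qed
qed

theorem theorem2:
  fixes n :: nat
  assumes "n \<ge> 1"
  shows "(\<exists>\<beta>. is_burau n \<beta>) \<and>
    (\<forall>\<beta>. is_burau n \<beta> \<longrightarrow>
      (\<exists>\<Phi> \<in> hom (LB_ext n) (GL n :: laurent_quot mat monoid).
        (\<forall>g \<in> carrier (LB n). \<Phi> g = map_mat laurent_proj (\<beta> g)) \<and>
        (\<forall>i\<in>{1..<n}. \<Phi> (tau n i) = tau_mat n i \<and> \<Phi> (sigma n i) = sigma_mat quot_t n i) \<and>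
        (\<forall>i\<in>{1..n}. \<Phi> (rho n i) = rho_mat quot_t n i)))"
proof (intro conjI allI impI)
  show "\<exists>\<beta>. is_burau n \<beta>"
    using is_burau_fox_mat by blast
next
  fix \<beta>
  assume "is_burau n \<beta>"
  then have "\<forall>g \<in> carrier (LB n). S.fox_mat n g = map_mat laurent_proj (\<beta> g)"
    by (simp add: is_burau_unique[OF _ is_burau_fox_mat] map_laurent_proj_fox_mat)
  then show "\<exists>\<Phi> \<in> hom (LB_ext n) (GL n :: laurent_quot mat monoid).
        (\<forall>g \<in> carrier (LB n). \<Phi> g = map_mat laurent_proj (\<beta> g)) \<and>
        (\<forall>i\<in>{1..<n}. \<Phi> (tau n i) = tau_mat n i \<and> \<Phi> (sigma n i) = sigma_mat quot_t n i) \<and>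
        (\<forall>i\<in>{1..n}. \<Phi> (rho n i) = rho_mat quot_t n i)"
    by (intro bexI[OF _ S.fox_mat_hom_LB_ext[OF refl]])
      (simp add: S.tau_values(2) S.sigma_values(2) S.rho_values(2)[OF refl])
qed

end
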